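(* Let $(X,U)\in\mathbb{R}^d\times\mathbb{R}^k$ have, given $(\theta,\eta)$, density $$\eta^{(d+k)/2}\,f\!\left(\eta\left(\|x-\theta\|^2+\|u\|^2\right)\right),\qquad \theta\in\mathbb{R}^d,\ \eta>0,$$ and let $(\theta,\eta)$ have the prior density $\pi_1(\theta)\,\eta^a$, $a\in\mathbb{R}$, with respect to $d\nu(\theta)\,d\eta$, where $\nu$ is a $\sigma$-finite measure on $\mathbb{R}^d$. Assume that the posterior distribution of $(\theta,\eta)$ is well-defined. Then: (a) Bayesian posterior inference about $\theta$ based solely on the posterior distribution of $\theta$ (such as Bayesian confidence regions, tests and predictors, as well as Bayes point estimators such as $\mathbb{E}(\theta|X,U)$) does not depend on the model density $f$. (b) If $\int_{\mathbb{R}_+}t^{a+b+\frac{d+k}{2}}f(t)\,dt<\infty$, then Bayes point estimators of $\theta$ under losses of the form $\eta^b\,\rho(\|\delta-\theta\|^2)$ do not, provided they exist, depend on the model density $f$. (c) In particular, for $b=1$ and $\rho(t)=t$, i.e. for the scale invariant squared-error loss $\eta\|\delta-\theta\|^2$, the Bayes point estimator of $\theta$ is $$\delta_{\pi_1,a}(x,u)=\frac{\displaystyle\int_{\mathbb{R}^d}\frac{\theta}{\left(\|\theta-x\|^2+\|u\|^2\right)^{a+2+\frac{d+k}{2}}}\,\pi_1(\theta)\,d\nu(\theta)}{\displaystyle\int_{\mathbb{R}^d}\frac{1}{\left(\|\theta-x\|^2+\|u\|^2\right)^{a+2+\frac{d+k}{2}}}\,\pi_1(\theta)\,d\nu(\theta)},$$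 provided that $\int_{\mathbb{R}_+}t^{a+1+\frac{d+k}{2}}f(t)\,dt<\infty$ and $\mathbb{E}\left(\frac{\|\theta\|^\ell}{\|\theta-x\|^2+\|u\|^2}\,\Big|\,x,u\right)<\infty$ for $\ell=0,1,2$.
   Context: $f:[0,\infty)\to[0,\infty)$ is a known function such that $t\mapsto f(\|t\|^2)$ is a probability density on $\mathbb{R}^{d+k}$. $\pi_1\ge 0$ is a (not necessarily normalizable, not $\nu$-a.e. zero) density with respect to $\nu$. The posterior distribution of $(\theta,\eta)$ given $(x,u)$ has density proportional to likelihood times prior density; it is well-defined when the normalizing constant is finite, i.e. $\int_{\mathbb{R}_+}t^{a+\frac{d+k}{2}}f(t)\,dt<\infty$ and $\int_{\mathbb{R}^d}\pi_1(z)\left(\|z-x\|^2+\|u\|^2\right)^{-(a+1+\frac{d+k}{2})}d\nu(z)<\infty$. In (b), $\rho$ is a real-valued function on $[0,\infty)$. A Bayes point estimator under a loss $L((\theta,\eta),\delta)$ is a minimizer $\delta=\delta(x,u)\in\mathbb{R}^d$ of the posterior expected loss $\mathbb{E}(L((\theta,\eta),\delta)\,|\,x,u)$. "Does not depend on $f$" means that, for a fixed prior and fixed $(x,u)$, all functions $f$ satisfying the stated conditions give the same object; in (a) this means that the posterior distribution of $\theta$ given $(x,u)$ is the same for all such $f$. *)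

theory Defs
  imports "HOL-Analysis.Analysis"
begin

definition is_prob_density :: "('n::euclidean_space \<Rightarrow> real) \<Rightarrow> bool" where
  "is_prob_density p \<longleftrightarrow>
     p \<in> borel_measurable borel \<and> (\<forall>t. 0 \<le> p t) \<and> (\<integral>\<^sup>+t. ennreal (p t) \<partial>lborel) = 1"

text \<open>The dimensions \<open>d\<close> and \<open>k\<close> are \<open>CARD('d)\<close> and \<open>CARD('k)\<close>. A function
  \<open>f : [0,\<infinity>) \<rightarrow> [0,\<infinity>)\<close> is a \<open>real \<Rightarrow> real\<close> whose values at negative arguments are
  never used.\<close>

definition half_dim :: "'d::finite itself \<Rightarrow> 'k::finite itself \<Rightarrow> real" where
  "half_dim _ _ = (real CARD('d) + real CARD('k)) / 2"

definition sq_resid :: "real^'d \<Rightarrow> real^'k \<Rightarrow> real^'d \<Rightarrow> real" where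
  "sq_resid x u \<theta> = (norm (\<theta> - x))\<^sup>2 + (norm u)\<^sup>2"

definition likelihood ::
  "(real \<Rightarrow> real) \<Rightarrow> real^'d::finite \<Rightarrow> real^'k::finite \<Rightarrow> real^'d \<Rightarrow> real \<Rightarrow> real" where
  "likelihood f x u \<theta> \<eta> =
     \<eta> powr half_dim TYPE('d) TYPE('k) * f (\<eta> * ((norm (x - \<theta>))\<^sup>2 + (norm u)\<^sup>2))"

definition prior_density :: "(real^'d \<Rightarrow> real) \<Rightarrow> real \<Rightarrow> real^'d \<Rightarrow> real \<Rightarrow> real" where
  "prior_density \<pi>1 a \<theta> \<eta> = \<pi>1 \<theta> * \<eta> powr a"

text \<open>The reference measure \<open>d\<nu>(\<theta>) d\<eta>\<close> on \<open>\<real>\<^sup>d \<times> (0,\<infinity>)\<close>.\<close>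

definition param_measure :: "(real^'d) measure \<Rightarrow> ((real^'d) \<times> real) measure" where
  "param_measure \<nu> = \<nu> \<Otimes>\<^sub>M restrict_space lborel {0<..}"

definition normalizing_constant ::
  "(real^'d::finite) measure \<Rightarrow> (real^'d \<Rightarrow> real) \<Rightarrow> real \<Rightarrow> (real \<Rightarrow> real)
     \<Rightarrow> real^'d \<Rightarrow> real^'k::finite \<Rightarrow> ennreal" where
  "normalizing_constant \<nu> \<pi>1 a f x u =
     (\<integral>\<^sup>+(\<theta>, \<eta>). ennreal (likelihood f x u \<theta> \<eta> * prior_density \<pi>1 a \<theta> \<eta>) \<partial>param_measure \<nu>)"

text \<open>The posterior distribution of \<open>(\<theta>,\<eta>)\<close> given \<open>(x,u)\<close>.\<close>

definition posterior ::
  "(real^'d::finite) measure \<Rightarrow> (real^'d \<Rightarrow> real) \<Rightarrow> real \<Rightarrow> (real \<Rightarrow> real)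
     \<Rightarrow> real^'d \<Rightarrow> real^'k::finite \<Rightarrow> ((real^'d) \<times> real) measure" where
  "posterior \<nu> \<pi>1 a f x u =
     density (param_measure \<nu>)
       (\<lambda>(\<theta>, \<eta>). ennreal (likelihood f x u \<theta> \<eta> * prior_density \<pi>1 a \<theta> \<eta>)
                  / normalizing_constant \<nu> \<pi>1 a f x u)"

text \<open>The density can be normalized. For \<open>u \<noteq> 0\<close> (an event of probability one) this is
  equivalent to finiteness of the two integrals in \<open>posterior_well_defined_iff\<close> below. If
  \<open>u = 0\<close> and \<open>\<nu>\<close> charges the point \<open>\<theta> = x\<close> with \<open>\<pi>1 x > 0\<close>, it forces \<open>f 0 = 0\<close>, so
  that the event \<open>\<theta> = x\<close> is then a null event of the posterior.\<close>

definition posterior_well_defined ::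
  "(real^'d::finite) measure \<Rightarrow> (real^'d \<Rightarrow> real) \<Rightarrow> real \<Rightarrow> (real \<Rightarrow> real)
     \<Rightarrow> real^'d \<Rightarrow> real^'k::finite \<Rightarrow> bool" where
  "posterior_well_defined \<nu> \<pi>1 a f x u \<longleftrightarrow>
     0 < normalizing_constant \<nu> \<pi>1 a f x u \<and> normalizing_constant \<nu> \<pi>1 a f x u < \<infinity>"

definition posterior_theta ::
  "(real^'d::finite) measure \<Rightarrow> (real^'d \<Rightarrow> real) \<Rightarrow> real \<Rightarrow> (real \<Rightarrow> real)
     \<Rightarrow> real^'d \<Rightarrow> real^'k::finite \<Rightarrow> (real^'d) measure" where
  "posterior_theta \<nu> \<pi>1 a f x u = distr (posterior \<nu> \<pi>1 a f x u) borel fst"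

text \<open>The moment \<open>\<integral>\<^bsub>\<real>\<^sub>+\<^esub> t\<^sup>q f(t) dt\<close>, as an element of \<open>[0,\<infinity>]\<close>.\<close>

definition radial_moment :: "(real \<Rightarrow> real) \<Rightarrow> real \<Rightarrow> ennreal" where
  "radial_moment f q = (\<integral>\<^sup>+t\<in>{0..}. ennreal (t powr q * f t) \<partial>lborel)"

text \<open>The conditions on the model density \<open>f\<close>, for a fixed prior and fixed \<open>(x,u)\<close>.\<close>

definition admissible_model ::
  "(real^'d::finite) measure \<Rightarrow> (real^'d \<Rightarrow> real) \<Rightarrow> real \<Rightarrow> (real \<Rightarrow> real)
     \<Rightarrow> real^'d \<Rightarrow> real^'k::finite \<Rightarrow> bool" where
  "admissible_model \<nu> \<pi>1 a f x u \<longleftrightarrow>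
     (\<forall>t\<ge>0. 0 \<le> f t) \<and>
     is_prob_density (\<lambda>t::real^('d + 'k). f ((norm t)\<^sup>2)) \<and>
     posterior_well_defined \<nu> \<pi>1 a f x u"

text \<open>Expectations of real-valued losses are taken in \<open>[-\<infinity>,\<infinity>]\<close>; they exist unless the
  positive and the negative part both have infinite integral. (Note that \<open>ennreal\<close> truncates
  negative numbers to \<open>0\<close>.)\<close>

definition expectation_exists :: "'p measure \<Rightarrow> ('p \<Rightarrow> real) \<Rightarrow> bool" where
  "expectation_exists M g \<longleftrightarrow>
     g \<in> borel_measurable M \<and>
     ((\<integral>\<^sup>+w. ennreal (g w) \<partial>M) < \<infinity> \<or> (\<integral>\<^sup>+w. ennreal (- g w) \<partial>M) < \<infinity>)"

definition ext_expectation :: "'p measure \<Rightarrow> ('p \<Rightarrow> real) \<Rightarrow> ereal" where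
  "ext_expectation M g =
     enn2ereal (\<integral>\<^sup>+w. ennreal (g w) \<partial>M) - enn2ereal (\<integral>\<^sup>+w. ennreal (- g w) \<partial>M)"

definition bayes_estimator :: "'p measure \<Rightarrow> ('p \<Rightarrow> 'e \<Rightarrow> real) \<Rightarrow> 'e \<Rightarrow> bool" where
  "bayes_estimator M L \<delta> \<longleftrightarrow>
     (\<forall>\<delta>'. expectation_exists M (\<lambda>w. L w \<delta>')) \<and>
     (\<forall>\<delta>'. ext_expectation M (\<lambda>w. L w \<delta>) \<le> ext_expectation M (\<lambda>w. L w \<delta>'))"

definition scaled_loss ::
  "real \<Rightarrow> (real \<Rightarrow> real) \<Rightarrow> (real^'d) \<times> real \<Rightarrow> real^'d \<Rightarrow> real" where
  "scaled_loss b \<rho> = (\<lambda>(\<theta>, \<eta>) \<delta>. \<eta> powr b * \<rho> ((norm (\<delta> - \<theta>))\<^sup>2))"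

definition delta_estimator ::
  "(real^'d::finite) measure \<Rightarrow> (real^'d \<Rightarrow> real) \<Rightarrow> real
     \<Rightarrow> real^'d \<Rightarrow> real^'k::finite \<Rightarrow> real^'d" where
  "delta_estimator \<nu> \<pi>1 a x u =
     (let q = a + 2 + half_dim TYPE('d) TYPE('k) in
       (\<integral>\<theta>. (\<pi>1 \<theta> / sq_resid x u \<theta> powr q) *\<^sub>R \<theta> \<partial>\<nu>)
         /\<^sub>R (\<integral>\<theta>. \<pi>1 \<theta> / sq_resid x u \<theta> powr q \<partial>\<nu>))"

subsection \<open>The normalizing constant\<close>

lemma borel_measurable_radial:
  fixes f :: "real \<Rightarrow> real"
  assumes "(\<lambda>t::real^'n::finite. f ((norm t)\<^sup>2)) \<in> borel_measurable borel"
  shows "(\<lambda>t. f t * indicator {0..} t) \<in> borel_measurable borel"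
proof -
  define e :: "real^'n" where "e = axis undefined 1"
  have e: "norm e = 1" by (simp add: e_def)
  have "(\<lambda>t. f ((norm (sqrt t *\<^sub>R e))\<^sup>2) * indicator {0..} t) \<in> borel_measurable borel"
    by (intro borel_measurable_times measurable_compose[OF _ assms]) auto
  also have "(\<lambda>t. f ((norm (sqrt t *\<^sub>R e))\<^sup>2) * indicator {0..} t) = (\<lambda>t. f t * indicator {0..} t)"
    by (auto simp: fun_eq_iff indicator_def e)
  finally show ?thesis .
qed

lemma radial_moment_scale:
  fixes f :: "real \<Rightarrow> real"
  assumes f: "(\<lambda>t. f t * indicator {0..} t) \<in> borel_measurable borel" and "0 < s"
  shows "(\<integral>\<^sup>+\<eta>\<in>{0<..}. ennreal (\<eta> powr q * f (\<eta> * s)) \<partial>lborel)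
         = ennreal (s powr - (q + 1)) * radial_moment f q"
proof -
  define f' where "f' = (\<lambda>t. f t * indicator {0..} t)"
  have [measurable]: "f' \<in> borel_measurable borel" using f by (simp add: f'_def)
  have "radial_moment f q = (\<integral>\<^sup>+t. ennreal (t powr q * f' t) \<partial>lborel)"
    unfolding radial_moment_def by (intro nn_integral_cong) (auto simp: f'_def indicator_def)
  also have "\<dots> = ennreal s * (\<integral>\<^sup>+t. ennreal ((s * t) powr q * f' (s * t)) \<partial>lborel)"
    using \<open>0 < s\<close> by (subst nn_integral_real_affine[where c=s and t=0]) auto
  also have "(\<integral>\<^sup>+t. ennreal ((s * t) powr q * f' (s * t)) \<partial>lborel)
      = (\<integral>\<^sup>+t. ennreal (s powr q) * (ennreal (t powr q * f (t * s)) * indicator {0<..} t) \<partial>lborel)"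
    (is "?l = _")
  proof (rule nn_integral_cong_AE, use AE_lborel_singleton[of "0::real"] in eventually_elim)
    case (elim t)
    then show ?case using \<open>0 < s\<close>
      by (cases "t > 0")
        (auto simp: f'_def indicator_def powr_mult ennreal_mult' zero_le_mult_iff mult_ac)
  qed
  also have "\<dots> = ennreal (s powr q) * (\<integral>\<^sup>+\<eta>\<in>{0<..}. ennreal (\<eta> powr q * f (\<eta> * s)) \<partial>lborel)"
  proof (rule nn_integral_cmult)
    have "(\<lambda>t. ennreal (t powr q * f (t * s)) * indicator {0<..} t)
        = (\<lambda>t. ennreal (t powr q * f' (t * s)) * indicator {0<..} t)"
      using \<open>0 < s\<close> by (auto simp: fun_eq_iff f'_def indicator_def)
    also have "\<dots> \<in> borel_measurable lborel" by measurable
    finally show "(\<lambda>t. ennreal (t powr q * f (t * s)) * indicator {0<..} t) \<in> borel_measurable lborel" .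
  qed
  finally have "radial_moment f q = ennreal s * (ennreal (s powr q) *
      (\<integral>\<^sup>+\<eta>\<in>{0<..}. ennreal (\<eta> powr q * f (\<eta> * s)) \<partial>lborel))" .
  moreover have "s powr - (q + 1) * (s * s powr q) = 1"
    using \<open>0 < s\<close> by (simp only: powr_minus powr_add powr_one) (simp add: field_simps)
  then have "ennreal (s powr - (q + 1)) * (ennreal s * (ennreal (s powr q) * y)) = y" for y
    using \<open>0 < s\<close> by (metis ennreal_1 ennreal_mult' less_imp_le mult.assoc mult.left_neutral powr_ge_zero)
  ultimately show ?thesis by simp
qed

lemma radial_moment_pos:
  fixes f :: "real \<Rightarrow> real"
  assumes nn: "\<And>t. 0 \<le> t \<Longrightarrow> 0 \<le> f t"
    and dens: "is_prob_density (\<lambda>t::real^'n::finite. f ((norm t)\<^sup>2))"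
  shows "radial_moment f q \<noteq> 0"
proof
  assume "radial_moment f q = 0"
  define f' where "f' = (\<lambda>t. f t * indicator {0..} t)"
  define g where "g = (\<lambda>t::real^'n. ennreal (f' ((norm t)\<^sup>2)))"
  have f'm: "f' \<in> borel_measurable borel"
    using dens unfolding f'_def is_prob_density_def by (intro borel_measurable_radial) auto
  note [measurable] = f'm
  have [measurable]: "g \<in> borel_measurable borel" unfolding g_def by measurable
  have g1: "(\<integral>\<^sup>+t. g t \<partial>lborel) = 1"
    using dens by (simp add: g_def f'_def is_prob_density_def)
  have "(\<integral>\<^sup>+t. ennreal (t powr q * f' t) \<partial>lborel) = radial_moment f q"
    unfolding radial_moment_def by (intro nn_integral_cong) (auto simp: f'_def indicator_def)
  with \<open>radial_moment f q = 0\<close> have "(\<integral>\<^sup>+t. ennreal (t powr q * f' t) \<partial>lborel) = 0"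
    by simp
  then have "AE t in lborel. ennreal (t powr q * f' t) = 0"
    by (subst (asm) nn_integral_0_iff_AE) auto
  then have ae: "AE t in lborel. f' t = 0"
    using AE_lborel_singleton[of "0::real"]
  proof eventually_elim
    case (elim t)
    then have "t powr q * f' t \<le> 0" by (simp add: ennreal_eq_0_iff)
    with elim show ?case using nn[of t]
      by (auto simp: f'_def indicator_def mult_le_0_iff split: if_splits)
  qed
  have 1: "(\<integral>\<^sup>+\<eta>. ennreal (f' (\<eta> * (norm t)\<^sup>2)) * indicator {1..2} \<eta> \<partial>lborel) = 0"
    if "t \<noteq> 0" for t :: "real^'n"
  proof -
    have r: "(norm t)\<^sup>2 > 0" using that by simp
    have "0 = (\<integral>\<^sup>+\<eta>. ennreal (f' \<eta>) \<partial>lborel)"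
      using ae by (subst nn_integral_0_iff_AE[THEN iffD2]) auto
    also have "\<dots> = ennreal ((norm t)\<^sup>2) * (\<integral>\<^sup>+\<eta>. ennreal (f' ((norm t)\<^sup>2 * \<eta>)) \<partial>lborel)"
      using r by (subst nn_integral_real_affine[where c="(norm t)\<^sup>2" and t=0]) auto
    finally have "(\<integral>\<^sup>+\<eta>. ennreal (f' ((norm t)\<^sup>2 * \<eta>)) \<partial>lborel) = 0"
      using r by (metis ennreal_eq_0_iff mult_eq_0_iff not_less)
    moreover have "(\<integral>\<^sup>+\<eta>. ennreal (f' (\<eta> * (norm t)\<^sup>2)) * indicator {1..2} \<eta> \<partial>lborel)
        \<le> (\<integral>\<^sup>+\<eta>. ennreal (f' ((norm t)\<^sup>2 * \<eta>)) \<partial>lborel)"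
      by (intro nn_integral_mono) (auto simp: indicator_def mult.commute)
    ultimately show ?thesis by simp
  qed
  have 2: "(\<integral>\<^sup>+t. ennreal (f' (\<eta> * (norm (t::real^'n))\<^sup>2)) * indicator {1..2} \<eta> \<partial>lborel)
      \<ge> ennreal (1 / 2 ^ CARD('n)) * indicator {1..2} \<eta>" for \<eta> :: real
  proof (cases "\<eta> \<in> {1..2}")
    case True
    define c where "c = sqrt \<eta>"
    have c: "c > 0" "c \<le> 2" using True by (auto simp: c_def intro: real_le_lsqrt)
    have "1 = (\<integral>\<^sup>+t. g t \<partial>density (distr lborel borel (\<lambda>x::real^'n. 0 + c *\<^sub>R x)) (\<lambda>_. \<bar>c\<bar>^DIM(real^'n)))"
      using lborel_affine[of c "0::real^'n"] c g1 by simp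
    also have "\<dots> = ennreal (c ^ CARD('n)) * (\<integral>\<^sup>+t. g (c *\<^sub>R t) \<partial>lborel)"
      using c by (simp add: nn_integral_density nn_integral_distr nn_integral_cmult ennreal_power)
    also have "(\<integral>\<^sup>+t. g (c *\<^sub>R t) \<partial>lborel) = (\<integral>\<^sup>+t. ennreal (f' (\<eta> * (norm (t::real^'n))\<^sup>2)) \<partial>lborel)"
      using True by (intro nn_integral_cong) (simp add: g_def c_def power_mult_distrib)
    also have "ennreal (c ^ CARD('n)) * \<dots> \<le> ennreal (2 ^ CARD('n)) * \<dots>"
      using c by (intro mult_right_mono ennreal_leI power_mono) auto
    finally have "ennreal (1 / 2 ^ CARD('n)) * 1 \<le> ennreal (1 / 2 ^ CARD('n)) *
       (ennreal (2 ^ CARD('n)) * (\<integral>\<^sup>+t. ennreal (f' (\<eta> * (norm (t::real^'n))\<^sup>2)) \<partial>lborel))"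
      by (intro mult_left_mono) auto
    also have "\<dots> = (\<integral>\<^sup>+t. ennreal (f' (\<eta> * (norm (t::real^'n))\<^sup>2)) \<partial>lborel)"
      by (simp add: mult.assoc[symmetric] ennreal_mult'[symmetric])
    finally show ?thesis using True by simp
  qed simp
  have "0 < ennreal (1 / 2 ^ CARD('n)) * emeasure lborel {1..2::real}" by simp
  also have "\<dots> = (\<integral>\<^sup>+\<eta>. ennreal (1 / 2 ^ CARD('n)) * indicator {1..2::real} \<eta> \<partial>lborel)"
    by (subst nn_integral_cmult_indicator) auto
  also have "\<dots> \<le> (\<integral>\<^sup>+\<eta>. (\<integral>\<^sup>+t. ennreal (f' (\<eta> * (norm (t::real^'n))\<^sup>2)) * indicator {1..2} \<eta> \<partial>lborel) \<partial>lborel)"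
    using 2 by (intro nn_integral_mono) auto
  also have "\<dots> = (\<integral>\<^sup>+t. (\<integral>\<^sup>+\<eta>. ennreal (f' (\<eta> * (norm (t::real^'n))\<^sup>2)) * indicator {1..2} \<eta> \<partial>lborel) \<partial>lborel)"
    by (rule lborel_pair.Fubini') measurable
  also have "\<dots> = 0"
    using AE_lborel_singleton[of "0::real^'n"] 1
    by (subst nn_integral_0_iff_AE) auto
  finally show False by simp
qed

lemma normalizing_constant_eq:
  fixes \<nu> :: "(real^'d::finite) measure" and u :: "real^'k::finite"
  assumes "sigma_finite_measure \<nu>" and sets: "sets \<nu> = sets borel"
    and \<pi>1: "\<pi>1 \<in> borel_measurable borel" "\<And>\<theta>. 0 \<le> \<pi>1 \<theta>"
    and dens: "is_prob_density (\<lambda>t::real^('d + 'k). f ((norm t)\<^sup>2))"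
    and "u \<noteq> 0"
  shows "normalizing_constant \<nu> \<pi>1 a f x u =
    (\<integral>\<^sup>+z. ennreal (\<pi>1 z * sq_resid x u z powr - (a + 1 + half_dim TYPE('d) TYPE('k))) \<partial>\<nu>)
      * radial_moment f (a + half_dim TYPE('d) TYPE('k))"
proof -
  define f' where "f' = (\<lambda>t. f t * indicator {0..} t)"
  define h where "h = half_dim TYPE('d) TYPE('k)"
  have f'm: "f' \<in> borel_measurable borel"
    using dens unfolding f'_def is_prob_density_def by (intro borel_measurable_radial) auto
  note [measurable] = f'm \<pi>1(1) and [measurable_cong] = sets
  have s: "sq_resid x u z > 0" for z
    using \<open>u \<noteq> 0\<close> by (simp add: sq_resid_def add_nonneg_pos)
  have [measurable]: "sq_resid x u \<in> borel_measurable borel"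
    unfolding sq_resid_def by measurable
  let ?R = "restrict_space lborel {0<..} :: real measure"
  have "sigma_finite_measure ?R"
    by (intro sigma_finite_measure_restrict_space lborel.sigma_finite_measure_axioms) auto
  then interpret R: sigma_finite_measure ?R .
  define G where "G = (\<lambda>(\<theta>, \<eta>). ennreal (\<pi>1 \<theta>) * ennreal (\<eta> powr (a + h) * f' (\<eta> * sq_resid x u \<theta>)))"
  have [measurable]: "G \<in> borel_measurable (\<nu> \<Otimes>\<^sub>M lborel)"
    unfolding G_def by measurable
  have Gm: "G \<in> borel_measurable (\<nu> \<Otimes>\<^sub>M ?R)"
  proof -
    have [measurable]: "(\<lambda>\<eta>. \<eta>) \<in> ?R \<rightarrow>\<^sub>M borel"
      by (simp add: measurable_restrict_space1)
    show ?thesis unfolding G_def by measurable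
  qed
  have "normalizing_constant \<nu> \<pi>1 a f x u = (\<integral>\<^sup>+w. G w \<partial>(\<nu> \<Otimes>\<^sub>M ?R))"
    unfolding normalizing_constant_def param_measure_def
  proof (intro nn_integral_cong, clarsimp simp: space_pair_measure space_restrict_space)
    fix \<theta> :: "real^'d" and \<eta> :: real assume "0 < \<eta>"
    then have "0 < \<eta> * sq_resid x u \<theta>" using s by simp
    then have "likelihood f x u \<theta> \<eta> * prior_density \<pi>1 a \<theta> \<eta>
        = \<pi>1 \<theta> * (\<eta> powr (a + h) * f' (\<eta> * sq_resid x u \<theta>))"
      by (simp add: likelihood_def prior_density_def f'_def sq_resid_def h_def[symmetric]
            norm_minus_commute powr_add)
    then show "ennreal (likelihood f x u \<theta> \<eta> * prior_density \<pi>1 a \<theta> \<eta>) = G (\<theta>, \<eta>)"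
      by (simp add: G_def ennreal_mult' \<pi>1)
  qed
  also have "\<dots> = (\<integral>\<^sup>+z. (\<integral>\<^sup>+\<eta>. G (z, \<eta>) \<partial>?R) \<partial>\<nu>)"
    using Gm by (rule R.nn_integral_fst[symmetric])
  also have "\<dots> = (\<integral>\<^sup>+z. ennreal (\<pi>1 z * sq_resid x u z powr - (a + 1 + h)) * radial_moment f (a + h) \<partial>\<nu>)"
  proof (intro nn_integral_cong)
    fix z
    have "(\<integral>\<^sup>+\<eta>. G (z, \<eta>) \<partial>?R) = (\<integral>\<^sup>+\<eta>. G (z, \<eta>) * indicator {0<..} \<eta> \<partial>lborel)"
      by (subst nn_integral_restrict_space) auto
    also have "\<dots> = (\<integral>\<^sup>+\<eta>. ennreal (\<pi>1 z) * (ennreal (\<eta> powr (a + h) * f' (\<eta> * sq_resid x u z)) * indicator {0<..} \<eta>) \<partial>lborel)"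
      by (simp add: G_def mult.assoc)
    also have "\<dots> = ennreal (\<pi>1 z) * (\<integral>\<^sup>+\<eta>\<in>{0<..}. ennreal (\<eta> powr (a + h) * f' (\<eta> * sq_resid x u z)) \<partial>lborel)"
      by (rule nn_integral_cmult) measurable
    also have "(\<integral>\<^sup>+\<eta>\<in>{0<..}. ennreal (\<eta> powr (a + h) * f' (\<eta> * sq_resid x u z)) \<partial>lborel)
        = ennreal (sq_resid x u z powr - (a + h + 1)) * radial_moment f (a + h)"
    proof -
      have "(\<integral>\<^sup>+\<eta>\<in>{0<..}. ennreal (\<eta> powr (a + h) * f' (\<eta> * sq_resid x u z)) \<partial>lborel)
          = (\<integral>\<^sup>+\<eta>\<in>{0<..}. ennreal (\<eta> powr (a + h) * f (\<eta> * sq_resid x u z)) \<partial>lborel)"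
        using s[of z] by (intro nn_integral_cong) (auto simp: f'_def indicator_def zero_le_mult_iff)
      then show ?thesis
        using radial_moment_scale[OF f'm[unfolded f'_def] s] by simp
    qed
    also have "ennreal (\<pi>1 z) * \<dots> = ennreal (\<pi>1 z * sq_resid x u z powr - (a + 1 + h)) * radial_moment f (a + h)"
      by (simp add: ennreal_mult' \<pi>1 mult.assoc add_ac)
    finally show "(\<integral>\<^sup>+\<eta>. G (z, \<eta>) \<partial>?R) = \<dots>" .
  qed
  also have "\<dots> = (\<integral>\<^sup>+z. ennreal (\<pi>1 z * sq_resid x u z powr - (a + 1 + h)) \<partial>\<nu>) * radial_moment f (a + h)"
    by (rule nn_integral_multc) measurable
  finally show ?thesis by (simp add: h_def)
qed

lemma posterior_well_defined_iff:
  fixes \<nu> :: "(real^'d::finite) measure" and u :: "real^'k::finite"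
  assumes \<nu>: "sigma_finite_measure \<nu>" and sets: "sets \<nu> = sets borel"
    and \<pi>1: "\<pi>1 \<in> borel_measurable borel" "\<And>\<theta>. 0 \<le> \<pi>1 \<theta>"
    and nz: "\<not> (AE \<theta> in \<nu>. \<pi>1 \<theta> = 0)"
    and f: "\<And>t. 0 \<le> t \<Longrightarrow> 0 \<le> f t"
    and dens: "is_prob_density (\<lambda>t::real^('d + 'k). f ((norm t)\<^sup>2))"
    and u: "u \<noteq> 0"
  shows "posterior_well_defined \<nu> \<pi>1 a f x u \<longleftrightarrow>
    radial_moment f (a + half_dim TYPE('d) TYPE('k)) < \<infinity> \<and>
    (\<integral>\<^sup>+z. ennreal (\<pi>1 z * sq_resid x u z powr - (a + 1 + half_dim TYPE('d) TYPE('k))) \<partial>\<nu>) < \<infinity>"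
    (is "_ \<longleftrightarrow> ?A < \<infinity> \<and> ?B < \<infinity>")
proof -
  note [measurable] = \<pi>1(1) and [measurable_cong] = sets
  have s: "sq_resid x u z > 0" for z
    using u by (simp add: sq_resid_def add_nonneg_pos)
  have [measurable]: "sq_resid x u \<in> borel_measurable borel"
    unfolding sq_resid_def by measurable
  have "?A \<noteq> 0" by (rule radial_moment_pos[OF f dens])
  moreover have "?B \<noteq> 0"
  proof
    assume "?B = 0"
    then have "AE z in \<nu>. ennreal (\<pi>1 z * sq_resid x u z powr - (a + 1 + half_dim TYPE('d) TYPE('k))) = 0"
      by (subst (asm) nn_integral_0_iff_AE) auto
    then have "AE z in \<nu>. \<pi>1 z = 0"
    proof eventually_elim
      case (elim z)
      then have "\<pi>1 z * sq_resid x u z powr - (a + 1 + half_dim TYPE('d) TYPE('k)) \<le> 0"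
        by (simp add: ennreal_eq_0_iff)
      then show ?case using s[of z] \<pi>1(2)[of z] by (auto simp: mult_le_0_iff)
    qed
    with nz show False by simp
  qed
  ultimately show ?thesis
    unfolding posterior_well_defined_def normalizing_constant_eq[OF \<nu> sets \<pi>1 dens u]
    by (auto simp: ennreal_mult_less_top less_top zero_less_iff_neq_zero ennreal_mult_eq_top_iff)
qed

end

theory Submission
  imports Defs
begin

text \<open>Let \<open>s(\<theta>) = \<parallel>\<theta> - x\<parallel>\<^sup>2 + \<parallel>u\<parallel>\<^sup>2\<close> and \<open>c = a + (d + k) / 2\<close>, so that the joint density is
  \<open>\<pi>1(\<theta>) \<eta>\<^sup>c f(\<eta> s(\<theta>))\<close>. Substituting \<open>t = \<eta> s(\<theta>)\<close> in the inner integral shows that the unnormalized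
  posterior integral of \<open>\<eta>\<^sup>b G(\<theta>)\<close> is \<open>\<integral> t powr (c + b) f(t) dt\<close> times the integral of \<open>G\<close> against
  \<open>\<pi>1(\<theta>) / s(\<theta>) powr (c + b + 1) d\<nu>(\<theta>)\<close>: the model density enters only through a positive factor.
  Bayes estimation under \<open>\<eta>\<^sup>b \<rho>(\<parallel>\<delta> - \<theta>\<parallel>\<^sup>2)\<close> is therefore Bayes estimation under \<open>\<rho>(\<parallel>\<delta> - \<theta>\<parallel>\<^sup>2)\<close>
  with respect to the latter measure, and for the squared error the estimator is its mean.
  The degenerate case \<open>s(\<theta>) = 0\<close> has posterior mass zero because \<open>\<integral> \<eta>\<^sup>c d\<eta> = \<infinity>\<close> for every \<open>c\<close>.\<close>

section \<open>A divergent power integral, and the mean as minimizer of squared error\<close>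

text \<open>Whatever the exponent, the integrand dominates \<open>1 / t\<close> on one side of 1,
  and \<open>1 / t\<close> has infinite integral on either side.\<close>

lemma nn_integral_powr_greaterThan_0:
  "(\<integral>\<^sup>+t\<in>{0<..}. ennreal (t powr q) \<partial>lborel) = \<infinity>"
proof -
  have "of_nat n \<le> (\<integral>\<^sup>+t\<in>{0<..}. ennreal (t powr q) \<partial>lborel)" for n
  proof -
    \<comment> \<open>The interval lies to the right of 1 if \<open>q \<ge> -1\<close> and to the
      left otherwise. Its endpoints make the integral of \<open>1 / t\<close> over it exactly
      \<open>n\<close>.\<close>
    define l u where "l = (if q \<ge> -1 then 1 else exp (- real n))"
      and "u = (if q \<ge> -1 then exp (real n) else 1)"
    have lu: "0 < l" "l \<le> u" "ln u - ln l = real n"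
      by (auto simp: l_def u_def)
    have le: "1 / t \<le> t powr q" if "t \<in> {l..u}" for t
    proof -
      have "t > 0" using that lu by simp
      then have "1 / t = t powr -1" by (simp add: powr_minus divide_simps)
      also have "\<dots> \<le> t powr q"
      proof (cases "q \<ge> -1")
        case True
        then show ?thesis using that by (intro powr_mono) (auto simp: l_def)
      next
        case False
        then show ?thesis using that \<open>t > 0\<close> by (intro powr_mono') (auto simp: u_def)
      qed
      finally show ?thesis .
    qed
    have "(\<integral>\<^sup>+t. ennreal (1 / t) * indicator {l..u} t \<partial>lborel) = ennreal (ln u - ln l)"
      using lu(1,2) by (intro nn_integral_FTC_Icc) 
        (auto intro!: DERIV_ln_divide simp: has_real_derivative_iff_has_vector_derivative[symmetric])
    also have "\<dots> = of_nat n" using lu by (simp add: ennreal_of_nat_eq_real_of_nat)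
    finally have "of_nat n = (\<integral>\<^sup>+t. ennreal (1 / t) * indicator {l..u} t \<partial>lborel)" ..
    also have "\<dots> \<le> (\<integral>\<^sup>+t\<in>{0<..}. ennreal (t powr q) \<partial>lborel)"
      using le lu(1) by (intro nn_integral_mono) (auto simp: indicator_def intro: ennreal_leI)
    finally show ?thesis .
  qed
  then show ?thesis
    by (metis ennreal_Ex_less_of_nat infinity_ennreal_def leD less_top)
qed

text \<open>Completing the square gives
  \<open>V \<delta> = V m + \<mu> * (norm (\<delta> - m))\<^sup>2\<close> with \<open>m\<close> the
  mean, so \<open>m\<close> is the only minimizer. The measure need not be normalized, hence the
  division by the total mass.\<close>

lemma bayes_estimator_squared_error_iff:
  fixes M :: "'a::euclidean_space measure"
  assumes "finite_measure M" and sets: "sets M = sets borel" and pos: "measure M (space M) > 0"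
    and int1: "integrable M (\<lambda>\<theta>. \<theta>)" and int2: "integrable M (\<lambda>\<theta>. (norm \<theta>)\<^sup>2)"
  shows "bayes_estimator M (\<lambda>\<theta> \<delta>. (norm (\<delta> - \<theta>))\<^sup>2) \<delta>
    \<longleftrightarrow> \<delta> = (\<integral>\<theta>. \<theta> \<partial>M) /\<^sub>R measure M (space M)"
proof -
  interpret finite_measure M by fact
  define \<mu> where "\<mu> = measure M (space M)"
  define m where "m = (\<integral>\<theta>. \<theta> \<partial>M) /\<^sub>R \<mu>"
  define V where "V = (\<lambda>\<delta>. \<integral>\<theta>. (norm (\<delta> - \<theta>))\<^sup>2 \<partial>M)"
  have \<mu>: "\<mu> > 0" using pos by (simp add: \<mu>_def)
  have expand: "(norm (\<delta> - \<theta>))\<^sup>2 = (norm \<delta>)\<^sup>2 - 2 * (\<delta> \<bullet> \<theta>) + (norm \<theta>)\<^sup>2" for \<delta> \<theta> :: 'a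
    by (simp add: power2_norm_eq_inner algebra_simps inner_commute)
  have int: "integrable M (\<lambda>\<theta>. (norm (\<delta> - \<theta>))\<^sup>2)" for \<delta>
    unfolding expand using int1 int2 by auto
  have "V \<delta> = (norm \<delta>)\<^sup>2 * \<mu> - 2 * (\<delta> \<bullet> (\<integral>\<theta>. \<theta> \<partial>M)) + (\<integral>\<theta>. (norm \<theta>)\<^sup>2 \<partial>M)" for \<delta>
    unfolding V_def expand using int1 int2 by (simp add: \<mu>_def)
  moreover have "(\<integral>\<theta>. \<theta> \<partial>M) = \<mu> *\<^sub>R m" using \<mu> by (simp add: m_def)
  ultimately have V_eq: "V \<delta> = (norm \<delta>)\<^sup>2 * \<mu> - 2 * \<mu> * (\<delta> \<bullet> m) + (\<integral>\<theta>. (norm \<theta>)\<^sup>2 \<partial>M)" for \<delta>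
    by simp
  have V: "V \<delta> = V m + \<mu> * (norm (\<delta> - m))\<^sup>2" for \<delta>
    unfolding V_eq[of \<delta>] V_eq[of m] expand by (simp add: power2_norm_eq_inner algebra_simps)
  have pos_part: "(\<integral>\<^sup>+\<theta>. ennreal ((norm (\<delta> - \<theta>))\<^sup>2) \<partial>M) = ennreal (V \<delta>)" for \<delta>
    unfolding V_def by (rule nn_integral_eq_integral[OF int]) simp
  have neg_part: "(\<integral>\<^sup>+\<theta>. ennreal (- ((norm (\<delta> - \<theta>))\<^sup>2)) \<partial>M) = 0" for \<delta>
    by (simp add: ennreal_neg)
  have V0: "V \<delta> \<ge> 0" for \<delta> unfolding V_def by simp
  have "expectation_exists M (\<lambda>\<theta>. (norm (\<delta> - \<theta>))\<^sup>2)" for \<delta>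
    unfolding expectation_exists_def neg_part using int by auto
  moreover have "ext_expectation M (\<lambda>\<theta>. (norm (\<delta> - \<theta>))\<^sup>2) = ereal (V \<delta>)" for \<delta>
    unfolding ext_expectation_def pos_part neg_part using V0 by (simp add: zero_ennreal.rep_eq)
  ultimately have "bayes_estimator M (\<lambda>\<theta> \<delta>. (norm (\<delta> - \<theta>))\<^sup>2) \<delta> \<longleftrightarrow> (\<forall>\<delta>'. V \<delta> \<le> V \<delta>')"
    unfolding bayes_estimator_def by simp
  also have "\<dots> \<longleftrightarrow> \<delta> = m"
  proof
    assume "\<forall>\<delta>'. V \<delta> \<le> V \<delta>'"
    then have "V m + \<mu> * (norm (\<delta> - m))\<^sup>2 \<le> V m" using V by metis
    then show "\<delta> = m" using \<mu> by (simp add: mult_le_0_iff)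
  next
    assume "\<delta> = m"
    then show "\<forall>\<delta>'. V \<delta> \<le> V \<delta>'"
      using V \<mu> by (metis le_add_same_cancel1 less_imp_le mult_nonneg_nonneg zero_le_power2)
  qed
  finally show ?thesis by (simp add: m_def \<mu>_def)
qed

text \<open>At \<open>\<theta> = x\<close>, \<open>u = 0\<close> the weight is the junk value \<open>\<pi>1 x / 0 = 0\<close>, which matches the fact
  that a well-defined posterior does not charge this point.\<close>

definition weighted_prior ::
  "(real^'d) measure \<Rightarrow> (real^'d \<Rightarrow> real) \<Rightarrow> real^'d \<Rightarrow> real^'k \<Rightarrow> real \<Rightarrow> (real^'d) measure" where
  "weighted_prior \<nu> \<pi>1 x u q = density \<nu> (\<lambda>\<theta>. ennreal (\<pi>1 \<theta> / sq_resid x u \<theta> powr q))"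

lemma sq_resid_nonneg: "0 \<le> sq_resid x u \<theta>"
  by (simp add: sq_resid_def)

lemma borel_measurable_sq_resid [measurable]: "sq_resid x u \<in> borel_measurable borel"
  unfolding sq_resid_def by measurable

text \<open>The exponent \<open>c\<close> is a parameter because, as a definition inside the locale, it would depend
  on the type variables of \<open>x\<close> and \<open>u\<close> without showing them in its type.\<close>

locale scale_model = sigma_finite_measure \<nu>
  for \<nu> :: "(real^'d::finite) measure" +
  fixes \<pi>1 :: "real^'d \<Rightarrow> real" and a :: real and f :: "real \<Rightarrow> real"
    and x :: "real^'d" and u :: "real^'k::finite" and c :: real
  assumes sets_\<nu>: "sets \<nu> = sets borel"
    and \<pi>1_measurable: "\<pi>1 \<in> borel_measurable borel"
    and \<pi>1_nonneg: "0 \<le> \<pi>1 \<theta>"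
    and admissible: "admissible_model \<nu> \<pi>1 a f x u"
    and c_eq: "c = a + half_dim TYPE('d) TYPE('k)"
begin

section \<open>The unnormalized posterior density\<close>

declare sets_\<nu> [measurable_cong] \<pi>1_measurable [measurable]

abbreviation "R \<equiv> restrict_space lborel {0<..} :: real measure"
abbreviation "M \<equiv> weighted_prior \<nu> \<pi>1 x u"
abbreviation "N \<equiv> normalizing_constant \<nu> \<pi>1 a f x u"
abbreviation "P \<equiv> posterior \<nu> \<pi>1 a f x u"

text \<open>Measurability of \<open>f\<close> is known only on the nonnegative half-line, its other
  values being arbitrary. The truncation is Borel measurable and changes nothing at the arguments
  \<open>\<eta> * sq_resid x u \<theta>\<close> with \<open>\<eta> > 0\<close>.\<close>

definition f' where "f' t = f t * indicator {0..} t"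

definition joint :: "(real^'d) \<times> real \<Rightarrow> ennreal" where
  "joint = (\<lambda>(\<theta>, \<eta>). ennreal (\<pi>1 \<theta> * (\<eta> powr c * f' (\<eta> * sq_resid x u \<theta>))))"

lemma f_nonneg: "0 \<le> t \<Longrightarrow> 0 \<le> f t" and f'_nonneg: "0 \<le> f' t"
  and is_prob_density_f: "is_prob_density (\<lambda>t::real^('d + 'k). f ((norm t)\<^sup>2))"
  and N_pos: "0 < N" and N_finite: "N < \<infinity>"
  using admissible
  by (auto simp: admissible_model_def posterior_well_defined_def f'_def indicator_def)

lemma f'_restrict_measurable: "(\<lambda>t. f t * indicator {0..} t) \<in> borel_measurable borel"
  using is_prob_density_f unfolding is_prob_density_def
  by (intro borel_measurable_radial) auto

lemma f'_measurable [measurable]: "f' \<in> borel_measurable borel"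
  using f'_restrict_measurable by (simp add: f'_def[abs_def])

lemma sigma_finite_R: "sigma_finite_measure R"
  by (intro sigma_finite_measure_restrict_space lborel.sigma_finite_measure_axioms) auto

lemma id_measurable_R: "(\<lambda>\<eta>. \<eta>) \<in> R \<rightarrow>\<^sub>M borel"
  by (simp add: measurable_restrict_space1)

lemma joint_measurable [measurable]: "joint \<in> borel_measurable (\<nu> \<Otimes>\<^sub>M R)"
proof -
  note [measurable] = id_measurable_R
  show ?thesis unfolding joint_def by measurable
qed

lemma snd_powr_measurable: "(\<lambda>w. snd w powr b) \<in> borel_measurable (\<nu> \<Otimes>\<^sub>M R)"
proof -
  note [measurable] = id_measurable_R
  show ?thesis by measurable
qed

lemma joint_eq:
  assumes "w \<in> space (\<nu> \<Otimes>\<^sub>M R)"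
  shows "(case w of (\<theta>, \<eta>) \<Rightarrow> ennreal (likelihood f x u \<theta> \<eta> * prior_density \<pi>1 a \<theta> \<eta>)) = joint w"
proof -
  obtain \<theta> \<eta> where w: "w = (\<theta>, \<eta>)" "\<eta> > 0"
    using assms by (auto simp: space_pair_measure space_restrict_space)
  then have "0 \<le> \<eta> * sq_resid x u \<theta>" by (simp add: sq_resid_nonneg)
  moreover have "\<eta> powr c = \<eta> powr half_dim TYPE('d) TYPE('k) * \<eta> powr a"
    by (simp add: c_eq powr_add)
  ultimately show ?thesis
    using w by (simp add: joint_def likelihood_def prior_density_def f'_def sq_resid_def
        norm_minus_commute mult_ac)
qed

lemma posterior_eq: "P = density (\<nu> \<Otimes>\<^sub>M R) (\<lambda>w. joint w / N)"
proof -
  have "(\<lambda>(\<theta>, \<eta>). ennreal (likelihood f x u \<theta> \<eta> * prior_density \<pi>1 a \<theta> \<eta>) / N) w = joint w / N"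
    if "w \<in> space (\<nu> \<Otimes>\<^sub>M R)" for w
    using joint_eq[OF that] by (cases w) auto
  \<comment> \<open>The two densities need not agree where \<open>\<eta> \<le> 0\<close>, outside
    the space. Comparing the integrals that define \<open>density\<close> needs only agreement on
    the space, and no measurability of the first density.\<close>
  then have "(\<integral>\<^sup>+w. (\<lambda>(\<theta>, \<eta>). ennreal (likelihood f x u \<theta> \<eta> * prior_density \<pi>1 a \<theta> \<eta>) / N) w
        * indicator A w \<partial>(\<nu> \<Otimes>\<^sub>M R))
      = (\<integral>\<^sup>+w. joint w / N * indicator A w \<partial>(\<nu> \<Otimes>\<^sub>M R))" for A
    by (intro nn_integral_cong) simp
  then show ?thesis
    unfolding posterior_def param_measure_def density_def by simp
qed

lemma N_eq: "N = (\<integral>\<^sup>+w. joint w \<partial>(\<nu> \<Otimes>\<^sub>M R))"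
  unfolding normalizing_constant_def param_measure_def
  by (intro nn_integral_cong) (rule joint_eq)

section \<open>Integrating out the scale parameter\<close>

text \<open>By Tonelli, finiteness of \<open>N\<close> makes the inner integral over
  \<open>\<eta>\<close> finite almost everywhere. Where \<open>sq_resid x u \<theta> = 0\<close> it
  equals \<open>\<pi>1 \<theta> * f 0\<close> times the divergent power integral, so that factor
  must vanish.\<close>

lemma AE_nondegenerate: "AE \<theta> in \<nu>. sq_resid x u \<theta> > 0 \<or> \<pi>1 \<theta> = 0 \<or> f 0 = 0"
proof -
  interpret R: sigma_finite_measure R by (rule sigma_finite_R)
  have "(\<integral>\<^sup>+\<theta>. (\<integral>\<^sup>+\<eta>. joint (\<theta>, \<eta>) \<partial>R) \<partial>\<nu>) \<noteq> \<infinity>"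
    using N_finite by (subst R.nn_integral_fst) (auto simp: N_eq)
  then have "AE \<theta> in \<nu>. (\<integral>\<^sup>+\<eta>. joint (\<theta>, \<eta>) \<partial>R) \<noteq> \<infinity>"
    by (intro nn_integral_PInf_AE) (auto intro!: R.borel_measurable_nn_integral_fst)
  then show ?thesis
  proof eventually_elim
    case (elim \<theta>)
    show ?case
    proof (rule ccontr)
      assume "\<not> ?case"
      then have s: "sq_resid x u \<theta> = 0" and pos: "\<pi>1 \<theta> * f 0 > 0"
        using sq_resid_nonneg[of x u \<theta>] \<pi>1_nonneg[of \<theta>] f_nonneg[of 0] by auto
      have "(\<integral>\<^sup>+\<eta>. joint (\<theta>, \<eta>) \<partial>R) = (\<integral>\<^sup>+\<eta>. joint (\<theta>, \<eta>) * indicator {0<..} \<eta> \<partial>lborel)"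
        by (subst nn_integral_restrict_space) auto
      also have "\<dots> = (\<integral>\<^sup>+\<eta>. ennreal (\<pi>1 \<theta> * f 0) * (ennreal (\<eta> powr c) * indicator {0<..} \<eta>) \<partial>lborel)"
      proof (rule nn_integral_cong)
        fix \<eta> :: real
        have "joint (\<theta>, \<eta>) = ennreal (\<pi>1 \<theta> * f 0 * \<eta> powr c)"
          by (simp add: joint_def f'_def s mult_ac)
        also have "\<dots> = ennreal (\<pi>1 \<theta> * f 0) * ennreal (\<eta> powr c)"
          using pos by (simp add: ennreal_mult)
        finally show "joint (\<theta>, \<eta>) * indicator {0<..} \<eta>
            = ennreal (\<pi>1 \<theta> * f 0) * (ennreal (\<eta> powr c) * indicator {0<..} \<eta>)"
          by (simp add: mult.assoc)
      qed
      also have "\<dots> = ennreal (\<pi>1 \<theta> * f 0) * \<infinity>"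
        by (subst nn_integral_cmult) (auto simp: nn_integral_powr_greaterThan_0)
      also have "\<dots> = \<infinity>" using pos by (auto simp: ennreal_mult_eq_top_iff)
      finally show False using elim by simp
    qed
  qed
qed

text \<open>Tonelli, then \<open>radial_moment_scale\<close> for each fixed \<open>\<theta>\<close>.
  Special choices of \<open>b\<close> and \<open>G\<close> give the normalizing constant, the
  marginal of \<open>\<theta>\<close> and the expected losses.\<close>

lemma nn_integral_joint:
  assumes [measurable]: "G \<in> borel_measurable borel"
  shows "(\<integral>\<^sup>+w. joint w * (ennreal (snd w powr b) * G (fst w)) \<partial>(\<nu> \<Otimes>\<^sub>M R))
    = radial_moment f (c + b) * (\<integral>\<^sup>+\<theta>. G \<theta> \<partial>M (c + b + 1))"
proof -
  interpret R: sigma_finite_measure R by (rule sigma_finite_R)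
  note [measurable] = snd_powr_measurable
  have "(\<integral>\<^sup>+w. joint w * (ennreal (snd w powr b) * G (fst w)) \<partial>(\<nu> \<Otimes>\<^sub>M R))
      = (\<integral>\<^sup>+\<theta>. (\<integral>\<^sup>+\<eta>. joint (\<theta>, \<eta>) * (ennreal (\<eta> powr b) * G \<theta>) \<partial>R) \<partial>\<nu>)"
    by (subst R.nn_integral_fst[symmetric]) auto
  also have "\<dots> = (\<integral>\<^sup>+\<theta>. radial_moment f (c + b) *
      (ennreal (\<pi>1 \<theta> / sq_resid x u \<theta> powr (c + b + 1)) * G \<theta>) \<partial>\<nu>)"
  proof (rule nn_integral_cong_AE, use AE_nondegenerate in eventually_elim)
    case (elim \<theta>)
    let ?s = "sq_resid x u \<theta>"
    have "(\<integral>\<^sup>+\<eta>. joint (\<theta>, \<eta>) * (ennreal (\<eta> powr b) * G \<theta>) \<partial>R)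
        = (\<integral>\<^sup>+\<eta>. joint (\<theta>, \<eta>) * (ennreal (\<eta> powr b) * G \<theta>) * indicator {0<..} \<eta> \<partial>lborel)"
      by (subst nn_integral_restrict_space) auto
    also have "\<dots> = (\<integral>\<^sup>+\<eta>. ennreal (\<pi>1 \<theta>) * G \<theta> *
        (ennreal (\<eta> powr (c + b) * f' (\<eta> * ?s)) * indicator {0<..} \<eta>) \<partial>lborel)"
      by (intro nn_integral_cong)
        (simp add: joint_def ennreal_mult' \<pi>1_nonneg f'_nonneg powr_add mult_ac)
    also have "\<dots> = ennreal (\<pi>1 \<theta>) * G \<theta> *
        (\<integral>\<^sup>+\<eta>\<in>{0<..}. ennreal (\<eta> powr (c + b) * f' (\<eta> * ?s)) \<partial>lborel)"
      by (rule nn_integral_cmult) measurable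
    also have "(\<integral>\<^sup>+\<eta>\<in>{0<..}. ennreal (\<eta> powr (c + b) * f' (\<eta> * ?s)) \<partial>lborel)
        = (\<integral>\<^sup>+\<eta>\<in>{0<..}. ennreal (\<eta> powr (c + b) * f (\<eta> * ?s)) \<partial>lborel)"
      using sq_resid_nonneg[of x u \<theta>]
      by (intro nn_integral_cong) (auto simp: f'_def indicator_def)
    also have "ennreal (\<pi>1 \<theta>) * G \<theta> * \<dots>
        = radial_moment f (c + b) * (ennreal (\<pi>1 \<theta> / ?s powr (c + b + 1)) * G \<theta>)"
    proof (cases "?s > 0")
      case True
      have "\<pi>1 \<theta> / ?s powr (c + b + 1) = \<pi>1 \<theta> * ?s powr - (c + b + 1)"
        by (simp only: powr_minus divide_inverse)
      then show ?thesis
        unfolding radial_moment_scale[OF f'_restrict_measurable True]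
        by (simp add: ennreal_mult' \<pi>1_nonneg mult_ac)
    next
      \<comment> \<open>Both sides are 0: on the left \<open>\<pi>1 \<theta>\<close> or
        \<open>f 0\<close> vanishes by \<open>AE_nondegenerate\<close>, on the right the weight is a
        division by \<open>0 powr (c + b + 1) = 0\<close>.\<close>
      case False
      then have "?s = 0" using sq_resid_nonneg[of x u \<theta>] by simp
      then show ?thesis using elim by auto
    qed
    finally show ?case .
  qed
  also have "\<dots> = radial_moment f (c + b) *
      (\<integral>\<^sup>+\<theta>. ennreal (\<pi>1 \<theta> / sq_resid x u \<theta> powr (c + b + 1)) * G \<theta> \<partial>\<nu>)"
    by (rule nn_integral_cmult) measurable
  also have "(\<integral>\<^sup>+\<theta>. ennreal (\<pi>1 \<theta> / sq_resid x u \<theta> powr (c + b + 1)) * G \<theta> \<partial>\<nu>)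
      = (\<integral>\<^sup>+\<theta>. G \<theta> \<partial>M (c + b + 1))"
    unfolding weighted_prior_def by (subst nn_integral_density) auto
  finally show ?thesis .
qed

lemma nn_integral_posterior:
  assumes [measurable]: "G \<in> borel_measurable borel"
  shows "(\<integral>\<^sup>+w. ennreal (snd w powr b) * G (fst w) \<partial>P)
    = radial_moment f (c + b) / N * (\<integral>\<^sup>+\<theta>. G \<theta> \<partial>M (c + b + 1))"
proof -
  note [measurable] = snd_powr_measurable
  have "(\<integral>\<^sup>+w. ennreal (snd w powr b) * G (fst w) \<partial>P)
      = (\<integral>\<^sup>+w. joint w / N * (ennreal (snd w powr b) * G (fst w)) \<partial>(\<nu> \<Otimes>\<^sub>M R))"
    unfolding posterior_eq by (rule nn_integral_density) measurable
  also have "\<dots> = (\<integral>\<^sup>+w. joint w * (ennreal (snd w powr b) * G (fst w)) / N \<partial>(\<nu> \<Otimes>\<^sub>M R))"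
    by (simp add: divide_ennreal_def mult_ac)
  also have "\<dots> = (\<integral>\<^sup>+w. joint w * (ennreal (snd w powr b) * G (fst w)) \<partial>(\<nu> \<Otimes>\<^sub>M R)) / N"
    by (rule nn_integral_divide) measurable
  also have "\<dots> = radial_moment f (c + b) * (\<integral>\<^sup>+\<theta>. G \<theta> \<partial>M (c + b + 1)) / N"
    by (simp only: nn_integral_joint[OF assms])
  finally show ?thesis
    by (simp add: divide_ennreal_def mult_ac)
qed

section \<open>The marginal posterior of \<theta>\<close>

lemma radial_moment_pos: "0 < radial_moment f q"
  using Defs.radial_moment_pos[OF f_nonneg is_prob_density_f] by (simp add: zero_less_iff_neq_zero)

lemma space_M [simp]: "space (M q) = UNIV"
  and sets_M [measurable_cong, simp]: "sets (M q) = sets borel"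
  using sets_eq_imp_space_eq[OF sets_\<nu>] by (auto simp: weighted_prior_def sets_\<nu>)

text \<open>The case \<open>b = 0\<close>, \<open>G = 1\<close> of \<open>nn_integral_joint\<close>.
  As \<open>N\<close> is positive and finite, so are both factors; this covers \<open>u = 0\<close>,
  where \<open>posterior_well_defined_iff\<close> does not apply.\<close>

lemma N_eq_mass: "N = radial_moment f c * emeasure (M (c + 1)) UNIV"
proof -
  \<comment> \<open>The factor \<open>snd w powr 0\<close> is 1 only because
    \<open>\<eta> > 0\<close> on the space; \<open>0 powr 0\<close> is 0.\<close>
  have "N = (\<integral>\<^sup>+w. joint w * (ennreal (snd w powr 0) * 1) \<partial>(\<nu> \<Otimes>\<^sub>M R))"
    unfolding N_eq by (intro nn_integral_cong) (auto simp: space_pair_measure space_restrict_space)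
  also have "\<dots> = radial_moment f (c + 0) * (\<integral>\<^sup>+\<theta>. 1 \<partial>M (c + 0 + 1))"
    by (rule nn_integral_joint) simp
  finally show ?thesis by simp
qed

lemma mass_pos: "0 < emeasure (M (c + 1)) UNIV"
  using N_pos by (auto simp: N_eq_mass zero_less_iff_neq_zero)

lemma radial_moment_c_finite: "radial_moment f c < \<infinity>"
  using N_finite mass_pos
  by (auto simp: N_eq_mass less_top[symmetric] ennreal_mult_eq_top_iff)

text \<open>The moment of \<open>f\<close> occurs in the numerator and in \<open>N\<close> and
  cancels, being positive and finite. The right side is free of \<open>f\<close>, which yields
  (a).\<close>

lemma emeasure_posterior_theta:
  assumes [measurable]: "A \<in> sets borel"
  shows "emeasure (posterior_theta \<nu> \<pi>1 a f x u) A = emeasure (M (c + 1)) A / emeasure (M (c + 1)) UNIV"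
proof -
  have [measurable_cong]: "sets P = sets (\<nu> \<Otimes>\<^sub>M R)" by (simp add: posterior_eq)
  have sp: "space P = space (\<nu> \<Otimes>\<^sub>M R)" by (simp add: posterior_eq)
  have "emeasure (posterior_theta \<nu> \<pi>1 a f x u) A
      = (\<integral>\<^sup>+\<theta>. indicator A \<theta> \<partial>posterior_theta \<nu> \<pi>1 a f x u)"
    by (subst nn_integral_indicator) (auto simp: posterior_theta_def)
  also have "\<dots> = (\<integral>\<^sup>+w. indicator A (fst w) \<partial>P)"
    unfolding posterior_theta_def by (subst nn_integral_distr) auto
  also have "\<dots> = (\<integral>\<^sup>+w. ennreal (snd w powr 0) * indicator A (fst w) \<partial>P)"
    by (intro nn_integral_cong) (auto simp: sp space_pair_measure space_restrict_space)
  also have "\<dots> = radial_moment f (c + 0) / N * (\<integral>\<^sup>+\<theta>. indicator A \<theta> \<partial>M (c + 0 + 1))"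
    by (rule nn_integral_posterior) simp
  also have "\<dots> = emeasure (M (c + 1)) A * radial_moment f c / (emeasure (M (c + 1)) UNIV * radial_moment f c)"
    by (simp add: N_eq_mass divide_ennreal_def mult_ac)
  also have "\<dots> = emeasure (M (c + 1)) A / emeasure (M (c + 1)) UNIV"
    using radial_moment_pos[of c] radial_moment_c_finite by (intro divide_mult_eq) auto
  finally show ?thesis .
qed

section \<open>Expected losses and Bayes estimators\<close>

text \<open>Since \<open>\<rho>\<close> is not assumed measurable, measurability of the loss is part
  of the existence of its expectation and must transfer in both directions.\<close>

lemma scaled_loss_measurable_iff:
  "(\<lambda>w. snd w powr b * r (fst w)) \<in> borel_measurable P \<longleftrightarrow> r \<in> borel_measurable borel"
proof
  have sets_P [measurable_cong]: "sets P = sets (\<nu> \<Otimes>\<^sub>M R)" by (simp add: posterior_eq)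
  note [measurable] = snd_powr_measurable
  {
    assume [measurable]: "r \<in> borel_measurable borel"
    show "(\<lambda>w. snd w powr b * r (fst w)) \<in> borel_measurable P"
      by measurable
  next
    assume m: "(\<lambda>w. snd w powr b * r (fst w)) \<in> borel_measurable P"
    txt \<open>The section of the loss at \<open>\<eta> = 1\<close> is \<open>r\<close>.\<close>
    have "(\<lambda>\<theta>. (\<theta>, 1::real)) \<in> borel \<rightarrow>\<^sub>M \<nu> \<Otimes>\<^sub>M R"
      by (intro measurable_Pair) (auto simp: space_restrict_space measurable_ident_sets sets_\<nu>)
    then have "(\<lambda>\<theta>. (\<theta>, 1::real)) \<in> borel \<rightarrow>\<^sub>M P"
      by (simp add: measurable_cong_sets[OF refl sets_P])
    from measurable_compose[OF this m] show "r \<in> borel_measurable borel" by simp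
  }
qed

text \<open>Truncation at 0 commutes with the nonnegative factor \<open>snd w powr b\<close>. So
  this handles the positive part of a loss and, applied to the negated \<open>r\<close>, the
  negative part.\<close>

lemma nn_integral_posterior_loss:
  assumes "r \<in> borel_measurable borel"
  shows "(\<integral>\<^sup>+w. ennreal (snd w powr b * r (fst w)) \<partial>P)
    = radial_moment f (c + b) / N * (\<integral>\<^sup>+\<theta>. ennreal (r \<theta>) \<partial>M (c + b + 1))"
  using nn_integral_posterior[of "\<lambda>\<theta>. ennreal (r \<theta>)" b] assms by (simp add: ennreal_mult')

lemma
  assumes fin: "radial_moment f (c + b) < \<infinity>"
  shows expectation_exists_posterior_iff:
      "expectation_exists P (\<lambda>w. snd w powr b * r (fst w)) \<longleftrightarrow> expectation_exists (M (c + b + 1)) r" (is ?A)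
    and ext_expectation_posterior:
      "r \<in> borel_measurable borel \<Longrightarrow> ext_expectation P (\<lambda>w. snd w powr b * r (fst w))
         = enn2ereal (radial_moment f (c + b) / N) * ext_expectation (M (c + b + 1)) r" (is "_ \<Longrightarrow> ?B")
    and radial_moment_divide_N: "0 < radial_moment f (c + b) / N" "radial_moment f (c + b) / N < \<infinity>"
proof -
  define K where "K = radial_moment f (c + b) / N"
  show K: "0 < radial_moment f (c + b) / N" "radial_moment f (c + b) / N < \<infinity>"
    using fin radial_moment_pos[of "c + b"] N_pos N_finite
    by (auto simp: ennreal_zero_less_divide less_top[symmetric] ennreal_divide_eq_top_iff)
  then have K0: "K \<noteq> 0" "K \<noteq> \<infinity>" by (auto simp: K_def)
  have neg: "(\<integral>\<^sup>+w. ennreal (- (snd w powr b * r (fst w))) \<partial>P)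
      = K * (\<integral>\<^sup>+\<theta>. ennreal (- r \<theta>) \<partial>M (c + b + 1))" if "r \<in> borel_measurable borel"
    using nn_integral_posterior_loss[of "\<lambda>\<theta>. - r \<theta>" b] that by (simp add: K_def)
  have pos: "(\<integral>\<^sup>+w. ennreal (snd w powr b * r (fst w)) \<partial>P)
      = K * (\<integral>\<^sup>+\<theta>. ennreal (r \<theta>) \<partial>M (c + b + 1))" if "r \<in> borel_measurable borel"
    using nn_integral_posterior_loss[of r b] that by (simp add: K_def)
  have fin_iff: "K * y < \<infinity> \<longleftrightarrow> y < \<infinity>" for y
    using K0 by (auto simp: less_top[symmetric] ennreal_mult_eq_top_iff)
  have meas_iff: "borel_measurable (M (c + b + 1)) = borel_measurable borel"
    by (rule measurable_cong_sets) auto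
  show ?A
    unfolding expectation_exists_def scaled_loss_measurable_iff meas_iff
    by (rule conj_cong) (simp_all only: pos neg fin_iff)
  obtain k where k: "K = ennreal k" "k > 0"
    using K0 by (cases K) auto
  \<comment> \<open>This includes the case of two infinite parts, where subtraction in
    \<open>ereal\<close> gives \<open>\<infinity>\<close> on both sides.\<close>
  have diff: "enn2ereal (K * p) - enn2ereal (K * q) = enn2ereal K * (enn2ereal p - enn2ereal q)" for p q
    using k by (cases p; cases q) (auto simp: times_ennreal.rep_eq ennreal.rep_eq algebra_simps ereal_mult_eq_PInfty)
  show ?B if "r \<in> borel_measurable borel"
    unfolding ext_expectation_def pos[OF that] neg[OF that] K_def[symmetric] by (rule diff)
qed

text \<open>All expected losses are multiplied by one positive finite constant, which preserves the
  minimizers. The right side does not involve \<open>f\<close>, which yields (b).\<close>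

lemma bayes_estimator_posterior_iff:
  assumes fin: "radial_moment f (a + b + half_dim TYPE('d) TYPE('k)) < \<infinity>"
  shows "bayes_estimator P (scaled_loss b \<rho>) \<delta> \<longleftrightarrow>
    bayes_estimator (M (c + b + 1)) (\<lambda>\<theta> \<delta>. \<rho> ((norm (\<delta> - \<theta>))\<^sup>2)) \<delta>"
proof -
  have fin': "radial_moment f (c + b) < \<infinity>" using fin by (simp add: c_eq add_ac)
  define K where "K = enn2ereal (radial_moment f (c + b) / N)"
  have K: "0 < K" "K < \<infinity>"
    using radial_moment_divide_N[OF fin'] by (auto simp: K_def less_ennreal.rep_eq top_ennreal.rep_eq zero_ennreal.rep_eq)
  define r where "r = (\<lambda>\<delta> \<theta>::real^'d. \<rho> ((norm (\<delta> - \<theta>))\<^sup>2))"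
  have loss: "(\<lambda>w. scaled_loss b \<rho> w \<delta>) = (\<lambda>w. snd w powr b * r \<delta> (fst w))" for \<delta> :: "real^'d"
    by (auto simp: scaled_loss_def r_def fun_eq_iff)
  let ?M = "M (c + b + 1)"
  have "bayes_estimator P (scaled_loss b \<rho>) \<delta> \<longleftrightarrow>
      (\<forall>\<delta>'. expectation_exists ?M (r \<delta>')) \<and>
      (\<forall>\<delta>'. ext_expectation P (\<lambda>w. snd w powr b * r \<delta> (fst w))
        \<le> ext_expectation P (\<lambda>w. snd w powr b * r \<delta>' (fst w)))"
    unfolding bayes_estimator_def loss expectation_exists_posterior_iff[OF fin'] by (rule refl)
  also have "\<dots> \<longleftrightarrow> (\<forall>\<delta>'. expectation_exists ?M (r \<delta>')) \<and>
      (\<forall>\<delta>'. ext_expectation ?M (r \<delta>) \<le> ext_expectation ?M (r \<delta>'))"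
  \<comment> \<open>The expectations are compared under the first conjunct, which supplies the
    measurability that \<open>ext_expectation_posterior\<close> requires.\<close>
  proof (rule conj_cong[OF refl])
    assume ex: "\<forall>\<delta>'. expectation_exists ?M (r \<delta>')"
    have "ext_expectation P (\<lambda>w. snd w powr b * r \<delta>' (fst w)) = K * ext_expectation ?M (r \<delta>')" for \<delta>'
      using ex unfolding K_def
      by (intro ext_expectation_posterior[OF fin'])
        (simp add: expectation_exists_def measurable_cong_sets[OF sets_M refl])
    then show "(\<forall>\<delta>'. ext_expectation P (\<lambda>w. snd w powr b * r \<delta> (fst w))
          \<le> ext_expectation P (\<lambda>w. snd w powr b * r \<delta>' (fst w)))
        \<longleftrightarrow> (\<forall>\<delta>'. ext_expectation ?M (r \<delta>) \<le> ext_expectation ?M (r \<delta>'))"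
      using K by (simp add: ereal_mult_le_mult_iff less_not_sym)
  qed
  also have "\<dots> \<longleftrightarrow> bayes_estimator ?M (\<lambda>\<theta> \<delta>. \<rho> ((norm (\<delta> - \<theta>))\<^sup>2)) \<delta>"
    by (simp add: bayes_estimator_def r_def)
  finally show ?thesis .
qed

section \<open>Scale invariant squared error\<close>

text \<open>The right side does not depend on \<open>q\<close>, so positive mass passes from
  exponent \<open>c + 1\<close> to \<open>c + 1 + 1\<close>.\<close>

lemma emeasure_M_eq_0_iff: "emeasure (M q) UNIV = 0 \<longleftrightarrow> (AE \<theta> in \<nu>. \<pi>1 \<theta> = 0 \<or> sq_resid x u \<theta> = 0)"
proof -
  have "emeasure (M q) UNIV = (\<integral>\<^sup>+\<theta>. ennreal (\<pi>1 \<theta> / sq_resid x u \<theta> powr q) \<partial>\<nu>)"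
    unfolding weighted_prior_def by (subst emeasure_density) (auto simp: sets_\<nu>)
  also have "\<dots> = 0 \<longleftrightarrow> (AE \<theta> in \<nu>. ennreal (\<pi>1 \<theta> / sq_resid x u \<theta> powr q) = 0)"
    by (rule nn_integral_0_iff_AE) measurable
  also have "\<dots> \<longleftrightarrow> (AE \<theta> in \<nu>. \<pi>1 \<theta> = 0 \<or> sq_resid x u \<theta> = 0)"
    using \<pi>1_nonneg sq_resid_nonneg
    by (intro AE_cong) (auto simp: ennreal_eq_0_iff divide_le_0_iff order_antisym)
  finally show ?thesis .
qed

text \<open>The divisor is absorbed into the weight. This turns the moment conditions of (c), which
  concern exponent \<open>c + 1\<close>, into moments of the measure with exponent
  \<open>c + 1 + 1\<close>.\<close>

lemma nn_integral_M_shift: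
  assumes [measurable]: "G \<in> borel_measurable borel"
  shows "(\<integral>\<^sup>+\<theta>. G \<theta> / ennreal (sq_resid x u \<theta>) \<partial>M q) = (\<integral>\<^sup>+\<theta>. G \<theta> \<partial>M (q + 1))"
proof -
  have "ennreal (\<pi>1 \<theta> / sq_resid x u \<theta> powr q) * (G \<theta> / ennreal (sq_resid x u \<theta>))
      = ennreal (\<pi>1 \<theta> / sq_resid x u \<theta> powr (q + 1)) * G \<theta>" for \<theta>
  proof (cases "sq_resid x u \<theta> > 0")
    case True
    then have "ennreal (\<pi>1 \<theta> / sq_resid x u \<theta> powr (q + 1))
        = ennreal (\<pi>1 \<theta> / sq_resid x u \<theta> powr q) / ennreal (sq_resid x u \<theta>)"
      by (simp add: divide_ennreal \<pi>1_nonneg powr_add)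
    then show ?thesis by (simp add: divide_ennreal_def mult_ac)
  next
    \<comment> \<open>Both weights are divisions by 0, hence 0, and in \<open>ennreal\<close> a zero
      factor annihilates even an infinite quotient.\<close>
    case False
    then show ?thesis using sq_resid_nonneg[of x u \<theta>] by simp
  qed
  then show ?thesis
    unfolding weighted_prior_def by (simp add: nn_integral_density)
qed

text \<open>The conditions for \<open>l = 0, 1, 2\<close> make the weighted prior finite, its mean
  integrable and its squared norm integrable, as \<open>bayes_estimator_squared_error_iff\<close>
  requires. The exponent \<open>c + 1 + 1\<close> is the one in
  \<open>delta_estimator\<close>.\<close>

lemma bayes_estimator_scaled_squared_error_iff:
  assumes fin: "radial_moment f (a + 1 + half_dim TYPE('d) TYPE('k)) < \<infinity>"
    and mom: "\<And>l. l \<in> {0, 1, 2::nat} \<Longrightarrow>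
      (\<integral>\<^sup>+(\<theta>, \<eta>). ennreal (norm \<theta> ^ l) / ennreal (sq_resid x u \<theta>) \<partial>P) < \<infinity>"
  shows "bayes_estimator P (scaled_loss 1 (\<lambda>t. t)) \<delta> \<longleftrightarrow> \<delta> = delta_estimator \<nu> \<pi>1 a x u"
proof -
  define w where "w = (\<lambda>\<theta>. \<pi>1 \<theta> / sq_resid x u \<theta> powr (c + 1 + 1))"
  have [measurable]: "w \<in> borel_measurable \<nu>" unfolding w_def by measurable
  have w0: "w \<theta> \<ge> 0" for \<theta> by (simp add: w_def \<pi>1_nonneg)
  have M_eq: "M (c + 1 + 1) = density \<nu> (\<lambda>\<theta>. ennreal (w \<theta>))"
    by (simp add: weighted_prior_def w_def)
  have moment: "(\<integral>\<^sup>+\<theta>. ennreal (norm \<theta> ^ l) \<partial>M (c + 1 + 1)) < \<infinity>" if l: "l \<in> {0, 1, 2}" for l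
  proof -
    have sp: "space P = space (\<nu> \<Otimes>\<^sub>M R)" by (simp add: posterior_eq)
    let ?G = "\<lambda>\<theta>. ennreal (norm \<theta> ^ l) / ennreal (sq_resid x u \<theta>)"
    have "(\<integral>\<^sup>+(\<theta>, \<eta>). ?G \<theta> \<partial>P) = (\<integral>\<^sup>+w. ennreal (snd w powr 0) * ?G (fst w) \<partial>P)"
      by (intro nn_integral_cong) (auto simp: sp space_pair_measure space_restrict_space)
    also have "\<dots> = radial_moment f (c + 0) / N * (\<integral>\<^sup>+\<theta>. ?G \<theta> \<partial>M (c + 0 + 1))"
      by (rule nn_integral_posterior) measurable
    also have "(\<integral>\<^sup>+\<theta>. ?G \<theta> \<partial>M (c + 0 + 1)) = (\<integral>\<^sup>+\<theta>. ennreal (norm \<theta> ^ l) \<partial>M (c + 1 + 1))"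
      by (subst nn_integral_M_shift) auto
    finally show ?thesis
      using mom[OF l] radial_moment_divide_N(1)[of 0] radial_moment_c_finite
      by (auto simp: less_top[symmetric] ennreal_mult_eq_top_iff)
  qed
  have "emeasure (M (c + 1 + 1)) (space (M (c + 1 + 1))) < \<infinity>" using moment[of 0] by simp
  then interpret M: finite_measure "M (c + 1 + 1)" by (intro finite_measureI) auto
  have "emeasure (M (c + 1 + 1)) UNIV \<noteq> 0"
    using mass_pos unfolding emeasure_M_eq_0_iff zero_less_iff_neq_zero by simp
  then have "measure (M (c + 1 + 1)) (space (M (c + 1 + 1))) > 0"
    using M.emeasure_eq_measure[of UNIV] by (auto simp: zero_less_measure_iff)
  moreover have "integrable (M (c + 1 + 1)) (\<lambda>\<theta>. \<theta>)"
    using moment[of 1] by (intro integrableI_bounded) auto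
  moreover have "integrable (M (c + 1 + 1)) (\<lambda>\<theta>. (norm \<theta>)\<^sup>2)"
    using moment[of 2] by (intro integrableI_bounded) auto
  ultimately have "bayes_estimator (M (c + 1 + 1)) (\<lambda>\<theta> \<delta>. (norm (\<delta> - \<theta>))\<^sup>2) \<delta> \<longleftrightarrow>
      \<delta> = (\<integral>\<theta>. \<theta> \<partial>M (c + 1 + 1)) /\<^sub>R measure (M (c + 1 + 1)) (space (M (c + 1 + 1)))"
    by (intro bayes_estimator_squared_error_iff M.finite_measure_axioms) auto
  also have "(\<integral>\<theta>. \<theta> \<partial>M (c + 1 + 1)) = (\<integral>\<theta>. w \<theta> *\<^sub>R \<theta> \<partial>\<nu>)"
    unfolding M_eq using w0 by (subst integral_density) auto
  also have "measure (M (c + 1 + 1)) (space (M (c + 1 + 1))) = (\<integral>\<theta>. w \<theta> \<partial>\<nu>)"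
  proof -
    have "measure (M (c + 1 + 1)) (space (M (c + 1 + 1))) = (\<integral>\<theta>. 1 \<partial>M (c + 1 + 1))" by simp
    also have "\<dots> = (\<integral>\<theta>. w \<theta> *\<^sub>R 1 \<partial>\<nu>)"
      unfolding M_eq using w0 by (subst integral_density) auto
    finally show ?thesis by simp
  qed
  also have "(\<integral>\<theta>. w \<theta> *\<^sub>R \<theta> \<partial>\<nu>) /\<^sub>R (\<integral>\<theta>. w \<theta> \<partial>\<nu>) = delta_estimator \<nu> \<pi>1 a x u"
    by (simp add: delta_estimator_def w_def Let_def c_eq add_ac)
  finally show ?thesis
    using bayes_estimator_posterior_iff[OF fin] by simp
qed

end

section \<open>Comparison of admissible models\<close>

theorem corollary3p1:
  fixes \<nu> :: "(real^'d::finite) measure"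
    and \<pi>1 :: "real^'d \<Rightarrow> real"
    and a :: real
    and x :: "real^'d"
    and u :: "real^'k::finite"
  assumes "sigma_finite_measure \<nu>"
    and "sets \<nu> = sets borel"
    and "\<pi>1 \<in> borel_measurable borel"
    and "\<And>\<theta>. 0 \<le> \<pi>1 \<theta>"
    and "\<not> (AE \<theta> in \<nu>. \<pi>1 \<theta> = 0)"
  shows
    "(\<forall>f1 f2. admissible_model \<nu> \<pi>1 a f1 x u \<longrightarrow> admissible_model \<nu> \<pi>1 a f2 x u \<longrightarrow>
        posterior_theta \<nu> \<pi>1 a f1 x u = posterior_theta \<nu> \<pi>1 a f2 x u)
   \<and> (\<forall>(b::real) (\<rho>::real \<Rightarrow> real) f1 f2.
        admissible_model \<nu> \<pi>1 a f1 x u \<longrightarrow> admissible_model \<nu> \<pi>1 a f2 x u \<longrightarrow>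
        radial_moment f1 (a + b + half_dim TYPE('d) TYPE('k)) < \<infinity> \<longrightarrow>
        radial_moment f2 (a + b + half_dim TYPE('d) TYPE('k)) < \<infinity> \<longrightarrow>
        (\<forall>\<delta>. bayes_estimator (posterior \<nu> \<pi>1 a f1 x u) (scaled_loss b \<rho>) \<delta> \<longleftrightarrow>
             bayes_estimator (posterior \<nu> \<pi>1 a f2 x u) (scaled_loss b \<rho>) \<delta>))
   \<and> (\<forall>f. admissible_model \<nu> \<pi>1 a f x u \<longrightarrow>
        radial_moment f (a + 1 + half_dim TYPE('d) TYPE('k)) < \<infinity> \<longrightarrow>
        (\<forall>l\<in>{0, 1, 2::nat}.
           (\<integral>\<^sup>+(\<theta>, \<eta>). ennreal (norm \<theta> ^ l) / ennreal (sq_resid x u \<theta>)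
              \<partial>posterior \<nu> \<pi>1 a f x u) < \<infinity>) \<longrightarrow>
        (\<forall>\<delta>. bayes_estimator (posterior \<nu> \<pi>1 a f x u) (scaled_loss 1 (\<lambda>t. t)) \<delta> \<longleftrightarrow>
             \<delta> = delta_estimator \<nu> \<pi>1 a x u))"
proof (intro conjI allI impI)
  \<comment> \<open>Each model density gets its own instance of the locale; the characterizations of
    the two instances then have the same right side.\<close>
  have model: "scale_model \<nu> \<pi>1 a f x u (a + half_dim TYPE('d) TYPE('k))" if "admissible_model \<nu> \<pi>1 a f x u" for f
    using assms(1-4) that by (simp add: scale_model_def scale_model_axioms_def)
  show "posterior_theta \<nu> \<pi>1 a f1 x u = posterior_theta \<nu> \<pi>1 a f2 x u"
    if "admissible_model \<nu> \<pi>1 a f1 x u" "admissible_model \<nu> \<pi>1 a f2 x u" for f1 f2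
    using scale_model.emeasure_posterior_theta[OF model[OF that(1)]]
      scale_model.emeasure_posterior_theta[OF model[OF that(2)]]
    by (intro measure_eqI) (auto simp: posterior_theta_def)
  show "bayes_estimator (posterior \<nu> \<pi>1 a f1 x u) (scaled_loss b \<rho>) \<delta> \<longleftrightarrow>
      bayes_estimator (posterior \<nu> \<pi>1 a f2 x u) (scaled_loss b \<rho>) \<delta>"
    if "admissible_model \<nu> \<pi>1 a f1 x u" "admissible_model \<nu> \<pi>1 a f2 x u"
      "radial_moment f1 (a + b + half_dim TYPE('d) TYPE('k)) < \<infinity>"
      "radial_moment f2 (a + b + half_dim TYPE('d) TYPE('k)) < \<infinity>" for b \<rho> f1 f2 \<delta>
    using scale_model.bayes_estimator_posterior_iff[OF model] that by blast
  show "bayes_estimator (posterior \<nu> \<pi>1 a f x u) (scaled_loss 1 (\<lambda>t. t)) \<delta> \<longleftrightarrow>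
      \<delta> = delta_estimator \<nu> \<pi>1 a x u"
    if "admissible_model \<nu> \<pi>1 a f x u"
      "radial_moment f (a + 1 + half_dim TYPE('d) TYPE('k)) < \<infinity>"
      "\<forall>l\<in>{0, 1, 2::nat}. (\<integral>\<^sup>+(\<theta>, \<eta>). ennreal (norm \<theta> ^ l) / ennreal (sq_resid x u \<theta>)
         \<partial>posterior \<nu> \<pi>1 a f x u) < \<infinity>" for f \<delta>
    using scale_model.bayes_estimator_scaled_squared_error_iff[OF model[OF that(1)] that(2)] that(3)
    by blast
qed

end
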